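(* Let $P$ be a distribution on $\mathbb{R}^k$ with density $|\mathbf{\Sigma}|^{-1/2}g\big((\mathbf{y}-\boldsymbol\mu)^T\mathbf{\Sigma}^{-1}(\mathbf{y}-\boldsymbol\mu)\big)$, where $\boldsymbol\mu\in\mathbb{R}^k$ and $\mathbf{\Sigma}$ is a positive definite symmetric $k\times k$ matrix. Let $\mathbf{C}$ be an affine equivariant covariance functional which possesses an influence function and is Fisher consistent for $\mathbf{\Sigma}$. Suppose that $\mathbf{\Sigma}=\mathbf{V}(\boldsymbol\theta_0)$ for some $\boldsymbol\theta_0\in\mathbb{R}^\ell$, where $\mathbf{V}(\boldsymbol\theta)=\theta_1\mathbf{L}_1+\cdots+\theta_\ell\mathbf{L}_\ell$ is linear with symmetric $k\times k$ matrices $\mathbf{L}_j$ such that $\mathbf{L}=[\mathrm{vec}(\mathbf{L}_1)\ \cdots\ \mathrm{vec}(\mathbf{L}_\ell)]$ is of full column rank. Let $\Pi_L$ be the projection onto the column space of $\mathbf{L}$ scaled by $\mathbf{\Sigma}^{-1}\otimes\mathbf{\Sigma}^{-1}$, and define the covariance functional $\mathbf{M}$ by $\mathrm{vec}(\mathbf{M})=\Pi_L\mathrm{vec}(\mathbf{C})$. Write $d(\mathbf{y})^2=(\mathbf{y}-\boldsymbol\mu)^T\mathbf{\Sigma}^{-1}(\mathbf{y}-\boldsymbol\mu)$, $d(\mathbf{y})\ge0$. Then the following holds. (i) The functional $\mathbf{M}$ is Fisher consistent for $\mathbf{\Sigma}$ and there exist functions $\alpha_C,\beta_C:[0,\infty)\to\mathbb{R}$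 such that $\mathrm{IF}(\mathbf{y};\mathrm{vec}(\mathbf{M}),P)$ is given by $$\alpha_C(d(\mathbf{y}))\,\mathbf{L}\big(\mathbf{L}^T(\mathbf{\Sigma}^{-1}\otimes\mathbf{\Sigma}^{-1})\mathbf{L}\big)^{-1}\mathbf{L}^T\,\mathrm{vec}\big(\mathbf{\Sigma}^{-1}(\mathbf{y}-\boldsymbol\mu)(\mathbf{y}-\boldsymbol\mu)^T\mathbf{\Sigma}^{-1}\big)-\beta_C(d(\mathbf{y}))\,\mathrm{vec}(\mathbf{\Sigma}).$$ (ii) If $\boldsymbol\theta(\cdot)\in\mathbb{R}^\ell$ is the functional such that $\mathrm{vec}(\mathbf{M}(\cdot))=\mathbf{L}\boldsymbol\theta(\cdot)$, then $\boldsymbol\theta$ is Fisher consistent for $\boldsymbol\theta_0$ and (with the same $\alpha_C,\beta_C$) $\mathrm{IF}(\mathbf{y};\boldsymbol\theta,P)$ is given by $$\alpha_C(d(\mathbf{y}))\big(\mathbf{L}^T(\mathbf{\Sigma}^{-1}\otimes\mathbf{\Sigma}^{-1})\mathbf{L}\big)^{-1}\mathbf{L}^T\,\mathrm{vec}\big(\mathbf{\Sigma}^{-1}(\mathbf{y}-\boldsymbol\mu)(\mathbf{y}-\boldsymbol\mu)^T\mathbf{\Sigma}^{-1}\big)-\beta_C(d(\mathbf{y}))\,\boldsymbol\theta_0 .$$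
   Context: $\mathrm{vec}$ stacks the columns of a matrix; $\otimes$ is the Kronecker product. A covariance functional $\mathbf{C}(\cdot)$ assigns a symmetric $k\times k$ matrix to probability measures on $\mathbb{R}^k$. It is Fisher consistent for $\mathbf{\Sigma}$ if $\mathbf{C}(P)=\mathbf{\Sigma}$ (similarly, $\boldsymbol\theta$ is Fisher consistent for $\boldsymbol\theta_0$ if $\boldsymbol\theta(P)=\boldsymbol\theta_0$). It is affine equivariant if $\mathbf{C}(P_{\mathbf{A}\mathbf{y}+\mathbf{b}})=\mathbf{A}\,\mathbf{C}(P_{\mathbf{y}})\mathbf{A}^T$ for every nonsingular $k\times k$ matrix $\mathbf{A}$ and $\mathbf{b}\in\mathbb{R}^k$, where $P_{\mathbf{y}}$ denotes the distribution of a random vector $\mathbf{y}$. Influence function: for $\mathbf{y}\in\mathbb{R}^k$ and $0<h<1$, with $\delta_{\mathbf{y}}$ the Dirac measure at $\mathbf{y}$, $$\mathrm{IF}(\mathbf{y};\mathbf{C},P)=\lim_{h\downarrow0}\frac{\mathbf{C}((1-h)P+h\delta_{\mathbf{y}})-\mathbf{C}(P)}{h},$$ if the limit exists; the same definition is used for vector-valued functionals such as $\mathrm{vec}(\mathbf{M})$ and $\boldsymbol\theta$. "Possesses an influence function" means this limit exists for every $\mathbf{y}\in\mathbb{R}^k$. Scaled projection: for $\mathbf{x}\in\mathbb{R}^{k^2}$, $\Pi_L\mathbf{x}=\mathbf{L}\boldsymbol\theta^*$, where $\boldsymbol\theta^*$ minimizes $(\mathbf{x}-\mathbf{L}\boldsymbol\theta)^T(\mathbf{\Sigma}^{-1}\otimes\mathbf{\Sigma}^{-1})(\mathbf{x}-\mathbf{L}\boldsymbol\theta)$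 over $\boldsymbol\theta\in\mathbb{R}^\ell$ (here $\mathbf{\Sigma}$ is the fixed matrix belonging to $P$). *)

theory Defs
  imports "HOL-Probability.Probability"
begin

section \<open>Vectorisation and Kronecker product\<close>

text \<open>
  The space \<open>\<real>\<close> to the power \<open>k * k\<close> is indexed by pairs \<open>(column, row)\<close>, the column being the
  outer (block) index: this is the index order of column stacking, and it matches the block
  structure of the Kronecker product, cf. \<open>kron_mult_vec_cols\<close>.  The constant \<open>vec\<close> of the library
  is something else, namely the constant vector.
\<close>

definition vec_cols :: "real^'n^'m \<Rightarrow> real^('n \<times> 'm)" where
  "vec_cols A = (\<chi> p. A $ snd p $ fst p)"

definition kron :: "real^'n^'m \<Rightarrow> real^'q^'p \<Rightarrow> real^('n \<times> 'q)^('m \<times> 'p)" (infixl "\<otimes>\<^sub>K" 75) where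
  "A \<otimes>\<^sub>K B = (\<chi> r c. A $ fst r $ fst c * B $ snd r $ snd c)"

lemma kron_mult_vec_cols:
  fixes A :: "real^'n^'m" and B :: "real^'q^'p" and X :: "real^'n^'q"
  shows "(A \<otimes>\<^sub>K B) *v vec_cols X = vec_cols (B ** X ** transpose A)"
proof (simp add: vec_eq_iff vec_cols_def kron_def matrix_vector_mult_def matrix_matrix_mult_def
      transpose_def, intro allI)
  fix a :: 'm and b :: 'p
  have "(\<Sum>j\<in>UNIV. A $ a $ fst j * B $ b $ snd j * X $ snd j $ fst j) =
      (\<Sum>j\<in>UNIV. \<Sum>i\<in>UNIV. A $ a $ j * B $ b $ i * X $ i $ j)"
    by (simp add: sum.cartesian_product case_prod_beta)
  also have "\<dots> = (\<Sum>j\<in>UNIV. (\<Sum>i\<in>UNIV. B $ b $ i * X $ i $ j) * A $ a $ j)"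
    by (simp add: sum_distrib_left sum_distrib_right mult_ac)
  finally show "(\<Sum>j\<in>UNIV. A $ a $ fst j * B $ b $ snd j * X $ snd j $ fst j) =
      (\<Sum>j\<in>UNIV. (\<Sum>i\<in>UNIV. B $ b $ i * X $ i $ j) * A $ a $ j)" .
qed

definition outer_square :: "real^'n \<Rightarrow> real^'n^'n" where
  "outer_square v = (columnvector v :: real^1^'n) ** (rowvector v :: real^'n^1)"

definition symmetric_mat :: "real^'n^'n \<Rightarrow> bool" where
  "symmetric_mat A \<longleftrightarrow> transpose A = A"

definition positive_definite_mat :: "real^'n^'n \<Rightarrow> bool" where
  "positive_definite_mat A \<longleftrightarrow> symmetric_mat A \<and> (\<forall>x. x \<noteq> 0 \<longrightarrow> x \<bullet> (A *v x) > 0)"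


section \<open>Distributions and functionals\<close>

text \<open>
  Distributions on \<open>real^'k\<close> are the Borel probability measures, i.e. the elements of
  \<open>space (prob_algebra borel)\<close>.  Functionals are total functions on measures; they are only
  constrained on, and only used at, Borel probability measures.
\<close>

definition mahalanobis_sq :: "real^'k \<Rightarrow> real^'k^'k \<Rightarrow> real^'k \<Rightarrow> real" where
  "mahalanobis_sq \<mu> S y = (y - \<mu>) \<bullet> (matrix_inv S *v (y - \<mu>))"

definition mahalanobis :: "real^'k \<Rightarrow> real^'k^'k \<Rightarrow> real^'k \<Rightarrow> real" where
  "mahalanobis \<mu> S y = sqrt (mahalanobis_sq \<mu> S y)"

text \<open>Only the values of the density generator \<open>g\<close> on \<open>{0..}\<close> matter.\<close>

definition has_elliptical_density ::
    "(real^'k) measure \<Rightarrow> (real \<Rightarrow> real) \<Rightarrow> real^'k \<Rightarrow> real^'k^'k \<Rightarrow> bool" where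
  "has_elliptical_density P g \<mu> S \<longleftrightarrow>
     (\<forall>t\<ge>0. g t \<ge> 0) \<and>
     (\<lambda>y. det S powr (- 1 / 2) * g (mahalanobis_sq \<mu> S y)) \<in> borel_measurable borel \<and>
     P = density lborel (\<lambda>y. ennreal (det S powr (- 1 / 2) * g (mahalanobis_sq \<mu> S y)))"

definition covariance_functional :: "((real^'k) measure \<Rightarrow> real^'k^'k) \<Rightarrow> bool" where
  "covariance_functional C \<longleftrightarrow> (\<forall>Q \<in> space (prob_algebra borel). symmetric_mat (C Q))"

definition affine_equivariant :: "((real^'k) measure \<Rightarrow> real^'k^'k) \<Rightarrow> bool" where
  "affine_equivariant C \<longleftrightarrow>
     (\<forall>Q \<in> space (prob_algebra borel). \<forall>A b. invertible A \<longrightarrow>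
        C (distr Q borel (\<lambda>y. A *v y + b)) = A ** C Q ** transpose A)"

definition fisher_consistent :: "('a measure \<Rightarrow> 'b) \<Rightarrow> 'a measure \<Rightarrow> 'b \<Rightarrow> bool" where
  "fisher_consistent T P v \<longleftrightarrow> T P = v"

text \<open>The contaminated distribution \<open>(1 - h) P + h \<delta>\<^sub>y\<close>; for \<open>0 \<le> h \<le> 1\<close> the set function below is a
  measure, see \<open>emeasure_contaminate\<close>.\<close>

definition contaminate :: "real \<Rightarrow> 'a \<Rightarrow> 'a measure \<Rightarrow> 'a measure" where
  "contaminate h y P = measure_of (space P) (sets P)
     (\<lambda>A. ennreal (1 - h) * emeasure P A + ennreal h * emeasure (return P y) A)"

lemma sets_contaminate [simp]: "sets (contaminate h y P) = sets P"
  and space_contaminate [simp]: "space (contaminate h y P) = space P"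
  by (simp_all add: contaminate_def)

lemma emeasure_contaminate:
  assumes "A \<in> sets P"
  shows "emeasure (contaminate h y P) A = ennreal (1 - h) * emeasure P A + ennreal h * indicator A y"
proof -
  have "emeasure (contaminate h y P) A =
      ennreal (1 - h) * emeasure P A + ennreal h * emeasure (return P y) A"
    unfolding contaminate_def
  proof (rule emeasure_measure_of_sigma)
    show "sigma_algebra (space P) (sets P)"
      by (rule sets.sigma_algebra_axioms)
    show "positive (sets P) (\<lambda>A. ennreal (1 - h) * emeasure P A + ennreal h * emeasure (return P y) A)"
      by (simp add: positive_def)
    show "countably_additive (sets P)
        (\<lambda>A. ennreal (1 - h) * emeasure P A + ennreal h * emeasure (return P y) A)"
    proof (rule countably_additiveI)
      fix F :: "nat \<Rightarrow> 'a set"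
      assume F: "range F \<subseteq> sets P" "disjoint_family F"
      have "(\<Sum>i. emeasure P (F i)) = emeasure P (\<Union>i. F i)"
        "(\<Sum>i. emeasure (return P y) (F i)) = emeasure (return P y) (\<Union>i. F i)"
        using F by (simp_all add: suminf_emeasure del: emeasure_return)
      then show "(\<Sum>i. ennreal (1 - h) * emeasure P (F i) + ennreal h * emeasure (return P y) (F i)) =
          ennreal (1 - h) * emeasure P (\<Union>i. F i) + ennreal h * emeasure (return P y) (\<Union>i. F i)"
        by (simp only: suminf_add [symmetric, OF summableI summableI] ennreal_suminf_cmult)
    qed
  qed (use assms in auto)
  then show ?thesis
    using assms by simp
qed

lemma contaminate_in_prob_algebra:
  fixes P :: "'a :: topological_space measure"
  assumes "P \<in> space (prob_algebra borel)" "0 \<le> h" "h \<le> 1"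
  shows "contaminate h y P \<in> space (prob_algebra borel)"
proof -
  have P: "sets P = sets borel" "prob_space P"
    using assms(1) by (auto simp: space_prob_algebra)
  have sp: "space P = UNIV"
    using sets_eq_imp_space_eq [OF P(1)] by simp
  have "emeasure (contaminate h y P) (space (contaminate h y P)) = 1"
    using prob_space.emeasure_space_1 [OF P(2)] assms(2,3) sp
    by (simp add: emeasure_contaminate P(1) flip: ennreal_plus)
  then show ?thesis
    using P(1) by (auto simp: space_prob_algebra intro: prob_spaceI)
qed

text \<open>\<open>has_influence y T P v\<close> says that \<open>IF(y; T, P)\<close> exists and equals \<open>v\<close>.\<close>

definition has_influence ::
    "'a \<Rightarrow> ('a measure \<Rightarrow> 'b::real_normed_vector) \<Rightarrow> 'a measure \<Rightarrow> 'b \<Rightarrow> bool" where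
  "has_influence y T P v \<longleftrightarrow>
     ((\<lambda>h. (T (contaminate h y P) - T P) /\<^sub>R h) \<longlongrightarrow> v) (at_right 0)"

definition possesses_influence_function ::
    "('a measure \<Rightarrow> 'b::real_normed_vector) \<Rightarrow> 'a measure \<Rightarrow> bool" where
  "possesses_influence_function T P \<longleftrightarrow> (\<forall>y. \<exists>v. has_influence y T P v)"


section \<open>Linear covariance structures\<close>

definition lin_cov :: "('l::finite \<Rightarrow> real^'k^'k) \<Rightarrow> real^'l \<Rightarrow> real^'k^'k" where
  "lin_cov Ls \<theta> = (\<Sum>j\<in>UNIV. (\<theta> $ j) *\<^sub>R Ls j)"

definition design_mat :: "('l::finite \<Rightarrow> real^'k^'k) \<Rightarrow> real^'l^('k \<times> 'k)" where
  "design_mat Ls = (\<chi> p j. vec_cols (Ls j) $ p)"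

lemma vec_cols_lin_cov: "vec_cols (lin_cov Ls \<theta>) = design_mat Ls *v \<theta>"
  by (simp add: vec_eq_iff vec_cols_def lin_cov_def design_mat_def matrix_vector_mult_def mult.commute)

text \<open>The projection \<open>\<Pi>\<^sub>L\<close> onto the column space of \<open>L\<close>, scaled by \<open>S\<inverse> \<otimes> S\<inverse>\<close>.  The minimiser is
  unique if \<open>S\<close> is positive definite and \<open>L\<close> has full column rank.\<close>

definition scaled_proj ::
    "real^'k^'k \<Rightarrow> real^'l^('k \<times> 'k) \<Rightarrow> real^('k \<times> 'k) \<Rightarrow> real^('k \<times> 'k)" where
  "scaled_proj S L x = L *v arg_min
     (\<lambda>\<theta>. (x - L *v \<theta>) \<bullet> ((matrix_inv S \<otimes>\<^sub>K matrix_inv S) *v (x - L *v \<theta>))) (\<lambda>\<theta>. True)"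

end

theory Submission
  imports Defs
begin

text \<open>
  For \<open>K = \<Sigma>\<inverse>\<close>, a reflection \<open>B\<close> that preserves the form \<open>\<langle>u, v\<rangle> = u\<^sup>T K v\<close> leaves \<open>P\<close> invariant when it is
  applied around \<open>\<mu>\<close>.  By affine equivariance the influence function \<open>X(y)\<close> of \<open>C\<close> then satisfies
  \<open>X(\<mu> + B (y - \<mu>)) = B X(y) B\<^sup>T\<close>.  Reflections that fix \<open>z = y - \<mu>\<close> therefore commute with \<open>X(y) K\<close>, so
  \<open>z\<close> and every vector orthogonal to \<open>z\<close> are eigenvectors of it and \<open>X(y) = \<alpha> z z\<^sup>T - \<beta> \<Sigma>\<close>.  Any two
  points at the same distance from \<open>\<mu>\<close> are exchanged by a reflection, hence \<open>\<alpha>\<close> and \<open>\<beta>\<close> depend only on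
  that distance.  Finally \<open>\<Pi>\<^sub>L\<close> is the linear map \<open>L (L\<^sup>T W L)\<inverse> L\<^sup>T W\<close>, which fixes \<open>vec \<Sigma>\<close> and can be taken
  out of the limit.  Working with \<open>K\<close>-reflections avoids a square root of \<open>\<Sigma>\<close>.
\<close>

subsection \<open>Positive definite matrices and the scaled projection\<close>

text \<open>Completing the square in \<open>x a\<close> leaves the Schur complement of
  \<open>A a a\<close> as coefficients on \<open>I\<close>. The form \<open>q\<close> is arbitrary
  so that the identity serves both scalars, with multiplication as the form, and vectors.\<close>

lemma quadratic_complete_square:
  fixes A :: "'i \<Rightarrow> 'i \<Rightarrow> real" and x :: "'i \<Rightarrow> 'v::real_vector" and q :: "'v \<Rightarrow> 'v \<Rightarrow> real"
  assumes "finite I" "a \<notin> I" "A a a \<noteq> 0"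
    and A: "\<And>i j. A i j = A j i"
    and q: "bilinear q" "\<And>u v. q u v = q v u"
  defines "p \<equiv> \<Sum>i\<in>I. (A a i / A a a) *\<^sub>R x i"
  shows "(\<Sum>i\<in>insert a I. \<Sum>j\<in>insert a I. A i j * q (x i) (x j)) =
    A a a * q (x a + p) (x a + p) +
    (\<Sum>i\<in>I. \<Sum>j\<in>I. (A i j - A a i * A a j / A a a) * q (x i) (x j))"
proof -
  have p1: "q p v = (\<Sum>i\<in>I. A a i / A a a * q (x i) v)" for v
  proof -
    have "linear (\<lambda>u. q u v)"
      using q(1) by (simp add: bilinear_def)
    then show ?thesis
      using q(1) by (simp add: p_def linear_sum[of "\<lambda>u. q u v"] bilinear_lmul)
  qed
  have p2: "q p p = (\<Sum>i\<in>I. \<Sum>j\<in>I. A a i * A a j / (A a a)\<^sup>2 * q (x i) (x j))"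
  proof -
    have "q p p = (\<Sum>i\<in>I. A a i / A a a * q p (x i))"
      by (subst p1) (metis q(2))
    also have "\<dots> = (\<Sum>i\<in>I. \<Sum>j\<in>I. A a i / A a a * (A a j / A a a * q (x i) (x j)))"
      unfolding p1 sum_distrib_left by (intro sum.cong refl) (metis q(2))
    finally show ?thesis
      by (simp add: power2_eq_square mult_ac)
  qed
  have "A a a * q (x a + p) (x a + p) = A a a * (q (x a) (x a) + 2 * q p (x a) + q p p)"
    using q(1) q(2)[of "x a" p] by (simp add: bilinear_ladd bilinear_radd)
  also have "\<dots> = A a a * q (x a) (x a) + 2 * (\<Sum>i\<in>I. A a i * q (x i) (x a)) +
      (\<Sum>i\<in>I. \<Sum>j\<in>I. A a i * A a j / A a a * q (x i) (x j))"
    unfolding p2 unfolding p1 using assms(3)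
    by (simp add: distrib_left sum_distrib_left power2_eq_square mult_ac)
  finally have *: "A a a * q (x a + p) (x a + p) = \<dots>" .
  have "(\<Sum>i\<in>I. A i a * q (x i) (x a)) = (\<Sum>i\<in>I. A a i * q (x i) (x a))"
    "(\<Sum>j\<in>I. A a j * q (x a) (x j)) = (\<Sum>i\<in>I. A a i * q (x i) (x a))"
    by (intro sum.cong refl, metis A q(2))+
  then have "(\<Sum>i\<in>insert a I. \<Sum>j\<in>insert a I. A i j * q (x i) (x j)) =
      A a a * q (x a) (x a) + 2 * (\<Sum>i\<in>I. A a i * q (x i) (x a)) + (\<Sum>i\<in>I. \<Sum>j\<in>I. A i j * q (x i) (x j))"
    using assms(1,2) by (simp add: sum.distrib)
  then show ?thesis
    unfolding * by (simp add: left_diff_distrib sum_subtractf)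
qed

lemma bilinear_times_real: "bilinear ((*) :: real \<Rightarrow> real \<Rightarrow> real)"
  by (auto simp: bilinear_def linear_iff algebra_simps)

text \<open>Induction on the index set; the Schur complement of one diagonal entry is again positive
  definite.\<close>

lemma tensor_form_positive:
  fixes A :: "'i \<Rightarrow> 'i \<Rightarrow> real" and q :: "'v::real_vector \<Rightarrow> 'v \<Rightarrow> real"
  assumes "finite I"
    and "\<And>i j. A i j = A j i"
    and "\<And>c i. i \<in> I \<Longrightarrow> c i \<noteq> 0 \<Longrightarrow> (\<Sum>i\<in>I. \<Sum>j\<in>I. A i j * (c i * c j)) > 0"
    and q: "bilinear q" "\<And>u v. q u v = q v u" "\<And>v. v \<noteq> 0 \<Longrightarrow> q v v > 0"
    and "i \<in> I" "x i \<noteq> 0"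
  shows "(\<Sum>i\<in>I. \<Sum>j\<in>I. A i j * q (x i) (x j)) > 0"
  using assms(1,2,3,7,8)
proof (induction I arbitrary: A i rule: finite_induct)
  case empty
  then show ?case by simp
next
  case (insert a I)
  \<comment> \<open>Testing positivity with the unit vector at \<open>a\<close> isolates the pivot
    \<open>A a a\<close>.\<close>
  have "(\<Sum>i\<in>insert a I. \<Sum>j\<in>insert a I. A i j * (of_bool (i = a) * of_bool (j = a))) > 0"
    by (rule insert.prems(2)[of a]) auto
  also have "(\<Sum>i\<in>insert a I. \<Sum>j\<in>insert a I. A i j * (of_bool (i = a) * of_bool (j = a))) = A a a"
  proof -
    have "(\<Sum>i\<in>I. \<Sum>j\<in>insert a I. A i j * (of_bool (i = a) * of_bool (j = a))) = 0"
      "(\<Sum>j\<in>I. A a j * (of_bool (a = a) * of_bool (j = a))) = 0"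
      using insert.hyps by (auto intro!: sum.neutral)
    then show ?thesis
      using insert.hyps by simp
  qed
  finally have pos: "A a a > 0" .
  define B where "B i j = A i j - A a i * A a j / A a a" for i j
  have B_sym: "B i j = B j i" for i j
    using insert.prems(1)[of i j] by (simp add: B_def)
  have schur: "(\<Sum>i\<in>insert a I. \<Sum>j\<in>insert a I. A i j * r (y i) (y j)) =
      A a a * r (y a + (\<Sum>i\<in>I. (A a i / A a a) *\<^sub>R y i)) (y a + (\<Sum>i\<in>I. (A a i / A a a) *\<^sub>R y i)) +
      (\<Sum>i\<in>I. \<Sum>j\<in>I. B i j * r (y i) (y j))"
    if "bilinear r" "\<And>u v. r u v = r v u" for r :: "'w::real_vector \<Rightarrow> 'w \<Rightarrow> real" and y
    unfolding B_def
    by (rule quadratic_complete_square) (use insert.hyps insert.prems(1) pos that in auto)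
  have B_pos: "(\<Sum>i\<in>I. \<Sum>j\<in>I. B i j * (c i * c j)) > 0" if "i \<in> I" "c i \<noteq> 0" for c i
  proof -
    \<comment> \<open>The vector \<open>c\<close> is extended to \<open>a\<close> by the value that
      makes the completed square vanish, so that only the Schur complement form of \<open>c\<close>
      is left.\<close>
    define e where "e = c(a := - (\<Sum>i\<in>I. A a i / A a a * c i))"
    have e: "e i = c i" if "i \<in> I" for i
      using that insert.hyps by (auto simp: e_def)
    have "0 < (\<Sum>i\<in>insert a I. \<Sum>j\<in>insert a I. A i j * (e i * e j))"
      by (rule insert.prems(2)[of i]) (use that e in auto)
    also have "\<dots> = (\<Sum>i\<in>I. \<Sum>j\<in>I. B i j * (e i * e j))"
    proof -
      have "e a + (\<Sum>i\<in>I. (A a i / A a a) *\<^sub>R e i) = 0"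
        by (simp add: e cong: sum.cong) (simp add: e_def)
      then show ?thesis
        by (simp add: schur[OF bilinear_times_real])
    qed
    finally show ?thesis
      by (simp add: e cong: sum.cong)
  qed
  define v where "v = x a + (\<Sum>i\<in>I. (A a i / A a a) *\<^sub>R x i)"
  have eq: "(\<Sum>i\<in>insert a I. \<Sum>j\<in>insert a I. A i j * q (x i) (x j)) =
      A a a * q v v + (\<Sum>i\<in>I. \<Sum>j\<in>I. B i j * q (x i) (x j))"
    unfolding v_def by (rule schur) (use q in auto)
  have q0: "q v v \<ge> 0"
    using q(3)[of v] bilinear_lzero[OF q(1)] by (cases "v = 0") auto
  show ?case
  \<comment> \<open>Either the Schur complement part is positive by induction and the square is
    nonnegative, or all vectors on \<open>I\<close> vanish and the square of \<open>x a\<close>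
    alone is positive.\<close>
  proof (cases "\<exists>i\<in>I. x i \<noteq> 0")
    case True
    then obtain j where "j \<in> I" "x j \<noteq> 0" by blast
    then have "(\<Sum>i\<in>I. \<Sum>j\<in>I. B i j * q (x i) (x j)) > 0"
      by (intro insert.IH B_sym B_pos)
    then show ?thesis
      unfolding eq using pos q0 by (simp add: add_nonneg_pos)
  next
    case False
    then have "v = x a" "v \<noteq> 0"
      using insert.prems(3,4) by (auto simp: v_def)
    moreover have "(\<Sum>i\<in>I. \<Sum>j\<in>I. B i j * q (x i) (x j)) = 0"
      using False bilinear_lzero[OF q(1)] by (auto intro!: sum.neutral)
    ultimately show ?thesis
      unfolding eq using pos q(3)[of v] by simp
  qed
qed

lemma symmetric_mat_inner:
  assumes "symmetric_mat A"
  shows "u \<bullet> (A *v v) = v \<bullet> (A *v u)"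
  using assms by (metis dot_lmul_matrix inner_commute symmetric_mat_def transpose_matrix_vector)

text \<open>Cutting \<open>x\<close> into blocks \<open>y i\<close> turns the form of the Kronecker
  product into the double sum of \<open>A $ i $ j * q (y i) (y j)\<close>, where \<open>q\<close> is
  the form of \<open>B\<close>. Then \<open>tensor_form_positive\<close> applies, and nothing has to
  be diagonalised.\<close>

lemma positive_definite_kron:
  fixes A :: "real^'m^'m" and B :: "real^'p^'p"
  assumes A: "positive_definite_mat A" and B: "positive_definite_mat B"
  shows "positive_definite_mat (A \<otimes>\<^sub>K B)"
  unfolding positive_definite_mat_def
proof (intro conjI allI impI)
  have sA: "A $ i $ j = A $ j $ i" for i j
    using A by (simp add: positive_definite_mat_def symmetric_mat_def vec_eq_iff transpose_def)
  have sB: "B $ i $ j = B $ j $ i" for i j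
    using B by (simp add: positive_definite_mat_def symmetric_mat_def vec_eq_iff transpose_def)
  show "symmetric_mat (A \<otimes>\<^sub>K B)"
    using sA sB by (simp add: symmetric_mat_def vec_eq_iff transpose_def kron_def)
  fix x :: "real^('m \<times> 'p)"
  assume "x \<noteq> 0"
  define y where "y i = (\<chi> a. x $ (i, a))" for i
  define q where "q u v = u \<bullet> (B *v v)" for u v
  from \<open>x \<noteq> 0\<close> obtain i where i: "y i \<noteq> 0"
    by (auto simp: y_def vec_eq_iff)
  have "(\<Sum>i\<in>UNIV. \<Sum>j\<in>UNIV. A $ i $ j * q (y i) (y j)) > 0"
  proof (rule tensor_form_positive[where i = i])
    show "bilinear q"
      by (auto simp: q_def bilinear_def linear_iff algebra_simps)
    show "q u v = q v u" for u v
      using B unfolding q_def positive_definite_mat_def by (blast intro: symmetric_mat_inner)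
    show "q v v > 0" if "v \<noteq> 0" for v
      using B that by (simp add: q_def positive_definite_mat_def)
    fix c :: "'m \<Rightarrow> real" and i
    assume "c i \<noteq> 0"
    then have "(\<chi> i. c i) \<noteq> 0"
      by (auto simp: vec_eq_iff)
    then have "(\<chi> i. c i) \<bullet> (A *v (\<chi> i. c i)) > 0"
      using A by (simp add: positive_definite_mat_def)
    then show "(\<Sum>i\<in>UNIV. \<Sum>j\<in>UNIV. A $ i $ j * (c i * c j)) > 0"
      by (simp add: inner_vec_def matrix_vector_mult_def sum_distrib_left mult_ac)
  qed (use sA i in auto)
  also have "(\<Sum>i\<in>UNIV. \<Sum>j\<in>UNIV. A $ i $ j * q (y i) (y j)) =
      (\<Sum>i\<in>UNIV. \<Sum>a\<in>UNIV. \<Sum>j\<in>UNIV. \<Sum>b\<in>UNIV. x $ (i, a) * (A $ i $ j * B $ a $ b * x $ (j, b)))"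
    unfolding q_def y_def inner_vec_def matrix_vector_mult_def
    by (simp add: sum_distrib_left mult_ac) (subst sum.swap, rule refl)
  also have "\<dots> = x \<bullet> ((A \<otimes>\<^sub>K B) *v x)"
  proof -
    have "(\<Sum>p\<in>UNIV. h p) = (\<Sum>i\<in>UNIV. \<Sum>a\<in>UNIV. h (i, a))" for h :: "'m \<times> 'p \<Rightarrow> real"
      by (simp add: sum.cartesian_product)
    then show ?thesis
      by (simp add: inner_vec_def matrix_vector_mult_def kron_def sum_distrib_left)
  qed
  finally show "x \<bullet> ((A \<otimes>\<^sub>K B) *v x) > 0" .
qed

lemma positive_definite_invertible:
  fixes A :: "real^'n^'n"
  assumes "positive_definite_mat A"
  shows "invertible A"
proof -
  have "\<forall>x. A *v x = 0 \<longrightarrow> x = 0"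
    using assms unfolding positive_definite_mat_def by (metis inner_zero_right less_irrefl)
  then show ?thesis
    by (simp add: invertible_left_inverse matrix_left_invertible_ker)
qed

lemma invertible_matrix_inv_mult:
  fixes A :: "real^'n^'n"
  assumes "invertible A"
  shows "A ** matrix_inv A = mat 1" "matrix_inv A ** A = mat 1"
  using assms someI_ex[of "\<lambda>B. A ** B = mat 1 \<and> B ** A = mat 1"]
  unfolding invertible_def matrix_inv_def by blast+

lemma positive_definite_matrix_inv:
  fixes A :: "real^'n^'n"
  assumes "positive_definite_mat A"
  shows "positive_definite_mat (matrix_inv A)"
  unfolding positive_definite_mat_def
proof (intro conjI allI impI)
  note inv = invertible_matrix_inv_mult[OF positive_definite_invertible[OF assms]]
  have A: "transpose A = A"
    using assms by (simp add: positive_definite_mat_def symmetric_mat_def)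
  have "transpose (matrix_inv A) ** A = mat 1"
    by (metis A inv(1) matrix_transpose_mul transpose_mat)
  then show "symmetric_mat (matrix_inv A)"
    unfolding symmetric_mat_def by (metis inv(1) matrix_mul_assoc matrix_mul_lid matrix_mul_rid)
  fix x :: "real^'n"
  assume "x \<noteq> 0"
  define y where "y = matrix_inv A *v x"
  have x: "A *v y = x"
    by (simp add: y_def matrix_vector_mul_assoc inv)
  then have "y \<noteq> 0"
    using \<open>x \<noteq> 0\<close> by auto
  then have "y \<bullet> (A *v y) > 0"
    using assms by (simp add: positive_definite_mat_def)
  then show "x \<bullet> (matrix_inv A *v x) > 0"
    by (simp add: x inner_commute flip: y_def)
qed

text \<open>The form of the Gram matrix at \<open>x\<close> is the form of \<open>W\<close> at
  \<open>L *v x\<close>, which is nonzero for nonzero \<open>x\<close> by injectivity. This makes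
  the normal equations of the weighted least squares problem uniquely solvable.\<close>

lemma positive_definite_gram:
  fixes L :: "real^'l^'n"
  assumes W: "positive_definite_mat W" and L: "inj ((*v) L)"
  shows "positive_definite_mat (transpose L ** W ** L)"
  unfolding positive_definite_mat_def
proof (intro conjI allI impI)
  show "symmetric_mat (transpose L ** W ** L)"
    using W by (simp add: positive_definite_mat_def symmetric_mat_def matrix_transpose_mul matrix_mul_assoc)
  fix x :: "real^'l"
  assume "x \<noteq> 0"
  then have "L *v x \<noteq> 0"
    using injD[OF L, of x 0] by auto
  then have "(L *v x) \<bullet> (W *v (L *v x)) > 0"
    using W by (simp add: positive_definite_mat_def)
  moreover have "x \<bullet> ((transpose L ** W ** L) *v x) = (L *v x) \<bullet> (W *v (L *v x))"
    by (simp add: dot_lmul_matrix transpose_matrix_vector inner_commute[of x] flip: matrix_vector_mul_assoc)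
      (simp add: inner_commute)
  ultimately show "x \<bullet> ((transpose L ** W ** L) *v x) > 0"
    by simp
qed

text \<open>The solution \<open>t\<close> of the normal equations has a residual that is
  \<open>W\<close>-orthogonal to the column space of \<open>L\<close>, so Pythagoras shows that it
  minimises. This yields the linear formula behind the \<open>arg_min\<close> of the
  definition.\<close>

lemma scaled_proj_eq:
  fixes L :: "real^'l^('k::finite \<times> 'k)"
  assumes S: "positive_definite_mat S" and L: "inj ((*v) L)"
  defines "W \<equiv> matrix_inv S \<otimes>\<^sub>K matrix_inv S"
  shows "scaled_proj S L x = L *v ((matrix_inv (transpose L ** W ** L) ** transpose L ** W) *v x)"
proof -
  define G where "G = transpose L ** W ** L"
  define t where "t = (matrix_inv G ** transpose L ** W) *v x"
  define f where "f \<theta> = (x - L *v \<theta>) \<bullet> (W *v (x - L *v \<theta>))" for \<theta>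
  have W: "positive_definite_mat W"
    unfolding W_def by (intro positive_definite_kron positive_definite_matrix_inv S)
  have "invertible G"
    unfolding G_def by (intro positive_definite_invertible positive_definite_gram W L)
  then have "G *v t = (transpose L ** W) *v x"
    by (simp add: t_def matrix_vector_mul_assoc matrix_mul_assoc invertible_matrix_inv_mult)
  then have orth: "transpose L *v (W *v (x - L *v t)) = 0"
    by (simp add: G_def matrix_vector_mult_diff_distrib matrix_vector_mul_assoc matrix_mul_assoc)
  \<comment> \<open>Pythagoras: the cross terms between the residual \<open>r\<close> and the vector
    \<open>s\<close> of the column space vanish by \<open>orth\<close>.\<close>
  have f: "f \<theta> = f t + (L *v (t - \<theta>)) \<bullet> (W *v (L *v (t - \<theta>)))" for \<theta>
  proof -
    define r s where "r = x - L *v t" and "s = L *v (t - \<theta>)"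
    have sW: "u \<bullet> (W *v v) = v \<bullet> (W *v u)" for u v
      using W unfolding positive_definite_mat_def by (blast intro: symmetric_mat_inner)
    have "s \<bullet> (W *v r) = (t - \<theta>) \<bullet> (transpose L *v (W *v r))"
      by (simp add: s_def transpose_matrix_vector dot_lmul_matrix inner_commute[of "t - \<theta>"])
        (simp add: inner_commute)
    then have "s \<bullet> (W *v r) = 0" "r \<bullet> (W *v s) = 0"
      using orth sW[of r s] by (simp_all add: r_def)
    moreover have "x - L *v \<theta> = r + s"
      by (simp add: r_def s_def matrix_vector_mult_diff_distrib)
    ultimately show ?thesis
      by (simp add: f_def r_def[symmetric] s_def[symmetric] inner_add_left inner_add_right
          matrix_vector_right_distrib)
  qed
  \<comment> \<open>\<open>arg_min\<close> picks some minimiser by choice. As \<open>t\<close>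
    attains the minimum, \<open>m\<close> has the same value as \<open>t\<close>, and the extra
    square in \<open>f\<close> forces equal images under \<open>L\<close>.\<close>
  define m where "m = arg_min f (\<lambda>\<theta>. True)"
  have nonneg: "v \<bullet> (W *v v) \<ge> 0" for v
    using W by (cases "v = 0") (auto simp: positive_definite_mat_def less_imp_le)
  have "f m = f t"
    unfolding m_def
  proof (rule arg_min_equality)
    show "f t \<le> f \<theta>" for \<theta>
      using f[of \<theta>] nonneg[of "L *v (t - \<theta>)"] by linarith
  qed simp
  then have "(L *v (t - m)) \<bullet> (W *v (L *v (t - m))) = 0"
    using f[of m] by linarith
  then have "L *v (t - m) = 0"
    using W unfolding positive_definite_mat_def by (metis less_irrefl)
  then have "L *v m = L *v t"
    by (simp add: matrix_vector_mult_diff_distrib)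
  then show ?thesis
    by (simp add: scaled_proj_def m_def f_def[abs_def] t_def G_def W_def)
qed

subsection \<open>Reflections of a quadratic form\<close>

text \<open>For positive definite \<open>K\<close> this is the reflection in the hyperplane
  orthogonal to \<open>w\<close> with respect to the form of \<open>K\<close>. For
  \<open>w = 0\<close> it is the identity, so the facts below hold for every
  \<open>w\<close>.\<close>

definition form_reflection :: "real^'k^'k \<Rightarrow> real^'k \<Rightarrow> real^'k \<Rightarrow> real^'k" where
  "form_reflection K w x = x - (2 * (w \<bullet> (K *v x)) / (w \<bullet> (K *v w))) *\<^sub>R w"

lemma linear_form_reflection: "linear (form_reflection K w)"
  by (rule linearI)
    (simp_all add: form_reflection_def matrix_vector_right_distrib inner_add_right
      matrix_vector_mult_scaleR distrib_left add_divide_distrib scaleR_add_left scaleR_diff_right mult_ac)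

lemma form_reflection_fixes: "w \<bullet> (K *v x) = 0 \<Longrightarrow> form_reflection K w x = x"
  by (simp add: form_reflection_def)

context
  fixes K :: "real^'k^'k"
  assumes K: "positive_definite_mat K"
begin

lemma form_commute: "u \<bullet> (K *v v) = v \<bullet> (K *v u)"
  using K unfolding positive_definite_mat_def by (blast intro: symmetric_mat_inner)

lemma form_eq_0_iff: "u \<bullet> (K *v u) = 0 \<longleftrightarrow> u = 0"
  using K unfolding positive_definite_mat_def by (metis inner_zero_left less_irrefl)

lemma form_reflection_pair:
  "w \<bullet> (K *v form_reflection K w x) = - (w \<bullet> (K *v x))"
  using form_eq_0_iff[of w]
  by (cases "w = 0")
    (simp_all add: form_reflection_def matrix_vector_mult_diff_distrib matrix_vector_mult_scaleR inner_diff_right)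

lemma form_reflection_involution: "form_reflection K w (form_reflection K w x) = x"
  unfolding form_reflection_def[of K w "form_reflection K w x"] form_reflection_pair
  by (simp add: form_reflection_def)

lemma form_reflection_adjoint:
  "form_reflection K w x \<bullet> (K *v y) = x \<bullet> (K *v form_reflection K w y)"
  using form_commute[of x w]
  by (simp add: form_reflection_def matrix_vector_mult_diff_distrib matrix_vector_mult_scaleR
      inner_diff_right inner_diff_left)

lemma form_reflection_isometry:
  "form_reflection K w x \<bullet> (K *v form_reflection K w y) = x \<bullet> (K *v y)"
  by (simp add: form_reflection_adjoint form_reflection_involution)

lemma form_reflection_self: "form_reflection K w w = - w"
  using form_eq_0_iff[of w] by (cases "w = 0") (simp_all add: form_reflection_def scaleR_2)

text \<open>For vectors of equal length the pairing of \<open>x - y\<close> with \<open>x\<close> is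
  half the squared length of \<open>x - y\<close>. The coefficient in the reflection is therefore 1,
  and exactly \<open>x - y\<close> is subtracted.\<close>

lemma form_reflection_swaps:
  assumes "x \<bullet> (K *v x) = y \<bullet> (K *v y)"
  shows "form_reflection K (x - y) x = y"
proof (cases "x = y")
  case True
  then show ?thesis by (simp add: form_reflection_def)
next
  case False
  then have "(x - y) \<bullet> (K *v (x - y)) \<noteq> 0"
    by (simp add: form_eq_0_iff)
  moreover have "2 * ((x - y) \<bullet> (K *v x)) = (x - y) \<bullet> (K *v (x - y))"
    using assms form_commute[of x y]
    by (simp add: matrix_vector_mult_diff_distrib inner_diff_left inner_diff_right)
  ultimately show ?thesis
    by (simp add: form_reflection_def)
qed

text \<open>An argument in the style of Schur's lemma: commuting with the reflections that fix
  \<open>z\<close> makes \<open>f\<close> a scalar on the orthogonal complement of \<open>z\<close>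
  and keeps \<open>f z\<close> on the line of \<open>z\<close>.\<close>

lemma commutes_with_stabilizing_reflections:
  assumes f: "linear f"
    and comm: "\<And>w x. w \<bullet> (K *v z) = 0 \<Longrightarrow> f (form_reflection K w x) = form_reflection K w (f x)"
  shows "\<exists>a b. \<forall>x. f x = b *\<^sub>R x + (a * (z \<bullet> (K *v x))) *\<^sub>R z"
proof -
  \<comment> \<open>The reflection along \<open>w\<close> negates \<open>f w\<close>, because it
    negates \<open>w\<close> and commutes with \<open>f\<close>; only multiples of \<open>w\<close>
    are negated.\<close>
  have eigen: "\<exists>c. f w = c *\<^sub>R w" if w: "w \<bullet> (K *v z) = 0" for w
  proof -
    have "- f w = form_reflection K w (f w)"
      using comm[OF w, of w] f by (simp add: form_reflection_self linear_neg)
    then have "2 *\<^sub>R f w = (2 * (w \<bullet> (K *v f w)) / (w \<bullet> (K *v w))) *\<^sub>R w"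
      by (simp add: form_reflection_def scaleR_2 algebra_simps)
    then have "f w = (1/2) *\<^sub>R ((2 * (w \<bullet> (K *v f w)) / (w \<bullet> (K *v w))) *\<^sub>R w)"
      by (metis scaleR_half_double scaleR_2)
    then show ?thesis
      by (metis scaleR_scaleR)
  qed
  \<comment> \<open>The eigenvalues on the complement agree: compare those of \<open>w\<close>,
    \<open>w0\<close> and \<open>w + w0\<close>. If the complement is zero, any \<open>b\<close>
    will do, and 0 is taken.\<close>
  obtain b where b: "f w = b *\<^sub>R w" if "w \<bullet> (K *v z) = 0" for w
  proof (cases "\<exists>w. w \<bullet> (K *v z) = 0 \<and> w \<noteq> 0")
    case False
    then show ?thesis
      using that[of 0] f by (metis linear_0 scaleR_zero_right)
  next
    case True
    then obtain w0 b where w0: "w0 \<bullet> (K *v z) = 0" "w0 \<noteq> 0" and b: "f w0 = b *\<^sub>R w0"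
      using eigen by blast
    have "f w = b *\<^sub>R w" if w: "w \<bullet> (K *v z) = 0" for w
    proof -
      obtain c where c: "f w = c *\<^sub>R w"
        using eigen[OF w] by blast
      obtain d where "f (w + w0) = d *\<^sub>R (w + w0)"
        using eigen[of "w + w0"] w w0 by (auto simp: inner_add_left)
      then have d: "(c - d) *\<^sub>R w = (d - b) *\<^sub>R w0"
        using f by (simp add: linear_add b c algebra_simps)
      show ?thesis
      proof (cases "d = b")
        case True
        then show ?thesis using d c by auto
      next
        \<comment> \<open>Here \<open>w0\<close> is a multiple of \<open>w\<close>, and so both have
          the same eigenvalue.\<close>
        case False
        define s where "s = inverse (d - b) * (c - d)"
        have "w0 = s *\<^sub>R w"
          using False arg_cong[OF d, of "\<lambda>v. inverse (d - b) *\<^sub>R v"] by (simp add: s_def)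
        then have "f w0 = c *\<^sub>R w0"
          using f c by (simp add: linear_cmul mult_ac)
        then show ?thesis
          using b c w0 by simp
      qed
    qed
    then show ?thesis using that by blast
  qed
  show ?thesis
  proof (cases "z = 0")
    case True
    then show ?thesis using b by auto
  next
    case False
    then have zz: "z \<bullet> (K *v z) \<noteq> 0"
      by (simp add: form_eq_0_iff)
    have orth: "w \<bullet> (K *v f z) = 0" if w: "w \<bullet> (K *v z) = 0" for w
    proof -
      have "form_reflection K w (f z) = f z"
        using comm[OF w, of z] form_reflection_fixes[OF w] by simp
      then show ?thesis
        using form_eq_0_iff[of w] by (cases "w = 0") (auto simp: form_reflection_def)
    qed
    define a where "a = z \<bullet> (K *v f z) / (z \<bullet> (K *v z))"
    \<comment> \<open>This is the component of \<open>f z\<close> orthogonal to \<open>z\<close>. By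
      \<open>orth\<close> it is also orthogonal to \<open>f z\<close>, hence to itself, and so it
      vanishes.\<close>
    define w where "w = f z - a *\<^sub>R z"
    have "w \<bullet> (K *v z) = 0"
      using zz form_commute[of "f z" z] by (simp add: w_def a_def inner_diff_left)
    moreover from this have "w \<bullet> (K *v w) = 0"
      using orth[of w] by (simp add: matrix_vector_mult_diff_distrib matrix_vector_mult_scaleR
          inner_diff_right w_def[THEN arg_cong[where f = "(*v) K"]])
    ultimately have fz: "f z = a *\<^sub>R z"
      by (simp add: form_eq_0_iff w_def)
    have "f x = b *\<^sub>R x + ((a - b) / (z \<bullet> (K *v z)) * (z \<bullet> (K *v x))) *\<^sub>R z" for x
    proof -
      \<comment> \<open>With \<open>p\<close> the coefficient of the projection of \<open>x\<close>
        to \<open>z\<close>, \<open>f\<close> acts as \<open>b\<close> on the remainder and as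
        \<open>a\<close> on \<open>p *\<^sub>R z\<close>.\<close>
      define p where "p = z \<bullet> (K *v x) / (z \<bullet> (K *v z))"
      have "(x - p *\<^sub>R z) \<bullet> (K *v z) = 0"
        using zz form_commute[of x z] by (simp add: p_def inner_diff_left)
      then have "f x - p *\<^sub>R f z = b *\<^sub>R (x - p *\<^sub>R z)"
        using b[of "x - p *\<^sub>R z"] f by (simp add: linear_diff linear_cmul)
      then have "f x = b *\<^sub>R x + ((a - b) * p) *\<^sub>R z"
        by (simp add: fz algebra_simps)
      then show ?thesis
        by (simp add: p_def)
    qed
    then show ?thesis by blast
  qed
qed

end

subsection \<open>Invariance of elliptical distributions\<close>

lemma linear_borel_measurable:
  fixes f :: "'a::euclidean_space \<Rightarrow> 'b::real_normed_vector"
  assumes "linear f"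
  shows "f \<in> borel_measurable borel"
  using assms by (simp add: borel_measurable_continuous_onI linear_continuous_on linear_conv_bounded_linear)

lemma nn_integral_lborel_translate:
  fixes F :: "'a::euclidean_space \<Rightarrow> ennreal"
  assumes "F \<in> borel_measurable borel"
  shows "(\<integral>\<^sup>+x. F (c + x) \<partial>lborel) = (\<integral>\<^sup>+x. F x \<partial>lborel)"
proof -
  have "(\<integral>\<^sup>+x. F x \<partial>lborel) = (\<integral>\<^sup>+x. F x \<partial>distr lborel borel ((+) c))"
    by (simp add: lborel_distr_plus)
  also have "\<dots> = (\<integral>\<^sup>+x. F (c + x) \<partial>lborel)"
    using assms by (subst nn_integral_distr) simp_all
  finally show ?thesis by simp
qed

text \<open>The change of variables formulas of the library need a well-ordered index type.  Here, the
  pushforward is translation invariant, and the double integral of \<open>1\<^sub>A(x) 1\<^sub>B(x + f y)\<close> shows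
  that it is a multiple of Lebesgue measure, as for Haar measures; the factor is \<open>1\<close> because \<open>f\<close> is an
  involution.\<close>

lemma lborel_distr_linear_involution:
  fixes f :: "'a::euclidean_space \<Rightarrow> 'a"
  assumes f: "linear f" and inv: "\<And>x. f (f x) = x"
  shows "distr lborel borel f = lborel"
proof (rule measure_eqI)
  note f_meas [measurable] = linear_borel_measurable[OF f]
  note f_vim = measurable_sets[OF f_meas, simplified]
  \<comment> \<open>The unit ball has positive finite measure, so it can be cancelled, and it is
    symmetric under negation, which absorbs a sign in the computation of
    \<open>prod\<close>.\<close>
  define A :: "'a set" where "A = ball 0 1"
  have A: "A \<in> sets borel" by (simp add: A_def)
  note [measurable] = A
  have prod: "emeasure lborel A * emeasure lborel (f -` B) = emeasure lborel B * emeasure lborel (f -` A)"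
    if B [measurable]: "B \<in> sets borel" for B
  proof -
    have "emeasure lborel A * emeasure lborel (f -` B) =
        (\<integral>\<^sup>+x. indicator A x * emeasure lborel (f -` B) \<partial>lborel)"
      by (simp add: nn_integral_multc)
    \<comment> \<open>The inner integral is translated by \<open>f x\<close>. Since
      \<open>f (f x + y) = x + f y\<close>, the integrand is then the indicator of \<open>B\<close>
      at \<open>x + f y\<close>.\<close>
    also have "\<dots> = (\<integral>\<^sup>+x. indicator A x * (\<integral>\<^sup>+y. indicator (f -` B) (f x + y) \<partial>lborel) \<partial>lborel)"
      using f_vim[OF B] by (subst nn_integral_lborel_translate) simp_all
    also have "\<dots> = (\<integral>\<^sup>+x. \<integral>\<^sup>+y. indicator A x * indicator B (x + f y) \<partial>lborel \<partial>lborel)"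
      using f by (subst nn_integral_cmult[symmetric]) (simp_all add: indicator_def linear_add inv)
    also have "\<dots> = (\<integral>\<^sup>+y. \<integral>\<^sup>+x. indicator A x * indicator B (x + f y) \<partial>lborel \<partial>lborel)"
      by (rule lborel_pair.Fubini'[symmetric]) simp
    also have "\<dots> = (\<integral>\<^sup>+y. \<integral>\<^sup>+x. indicator A (x - f y) * indicator B x \<partial>lborel \<partial>lborel)"
    proof (rule nn_integral_cong)
      fix y
      show "(\<integral>\<^sup>+x. indicator A x * indicator B (x + f y) \<partial>lborel) =
          (\<integral>\<^sup>+x. indicator A (x - f y) * indicator B x \<partial>lborel)"
        by (subst nn_integral_lborel_translate[where c = "- f y", symmetric]) simp_all
    qed
    also have "\<dots> = (\<integral>\<^sup>+x. \<integral>\<^sup>+y. indicator A (x - f y) * indicator B x \<partial>lborel \<partial>lborel)"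
      by (rule lborel_pair.Fubini') simp
    also have "\<dots> = (\<integral>\<^sup>+x. indicator B x * (\<integral>\<^sup>+y. indicator (f -` A) (- f x + y) \<partial>lborel) \<partial>lborel)"
      using f f_vim[OF A]
      by (subst nn_integral_cmult[symmetric])
        (simp_all add: indicator_def linear_diff inv A_def dist_norm norm_minus_commute mult.commute)
    also have "\<dots> = emeasure lborel B * emeasure lborel (f -` A)"
      using f_vim[OF A] by (subst nn_integral_lborel_translate) (simp_all add: nn_integral_multc)
    finally show ?thesis .
  qed
  have vim2: "f -` f -` A = A"
    using inv by auto
  have fin: "emeasure lborel A < \<top>"
    unfolding A_def using emeasure_lborel_ball_finite[of 0 1] by simp
  have pos: "emeasure lborel A \<noteq> 0"
    unfolding A_def using content_ball_pos[of 1 "0 :: 'a"] by (auto simp: measure_def)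
  \<comment> \<open>Taking the preimage of \<open>A\<close> for \<open>B\<close> in
    \<open>prod\<close> gives equal squares, because applying the preimage twice returns
    \<open>A\<close>.\<close>
  have sq: "emeasure lborel A * emeasure lborel A = emeasure lborel (f -` A) * emeasure lborel (f -` A)"
    using prod[OF f_vim[OF A]] by (simp add: vim2)
  have fA: "emeasure lborel (f -` A) = emeasure lborel A"
  proof -
    obtain r where r: "emeasure lborel A = ennreal r" "r \<ge> 0"
      using fin by (cases "emeasure lborel A") auto
    show ?thesis
    proof (cases "emeasure lborel (f -` A)")
      case (real t)
      then have "r * r = t * t"
        using sq r by (simp flip: ennreal_mult)
      then have "r = t"
        using real r by (simp add: power2_eq_iff_nonneg flip: power2_eq_square)
      then show ?thesis
        using r real by simp
    next
      case top
      then show ?thesis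
        using sq r by (simp flip: ennreal_mult)
    qed
  qed
  fix B assume "B \<in> sets (distr lborel borel f)"
  then show "emeasure (distr lborel borel f) B = emeasure lborel B"
    using prod[of B] pos fin by (auto simp: fA emeasure_distr ennreal_mult_cancel_left mult.commute)
qed simp

lemma lborel_distr_affine_involution:
  fixes f :: "real^'n \<Rightarrow> real^'n"
  assumes f: "linear f" and inv: "\<And>x. f (f x) = x"
  shows "distr lborel borel (\<lambda>y. m + f (y - m)) = lborel"
proof -
  note f_meas = linear_borel_measurable[OF f]
  have "distr lborel borel (\<lambda>y. m + f (y - m)) =
      distr (distr (distr lborel borel ((+) (- m))) borel f) borel ((+) m)"
    using f_meas by (simp add: distr_distr o_def)
  also have "\<dots> = lborel"
    by (simp add: lborel_distr_plus lborel_distr_linear_involution[OF f inv])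
  finally show ?thesis .
qed

text \<open>The density depends on \<open>y\<close> only through the form at
  \<open>y - \<mu>\<close>, which the reflection preserves, and Lebesgue measure is preserved as
  well.\<close>

lemma elliptical_distr_reflection:
  assumes S: "positive_definite_mat S" and P: "has_elliptical_density P g \<mu> S"
  shows "distr P borel (\<lambda>y. \<mu> + form_reflection (matrix_inv S) w (y - \<mu>)) = P"
proof -
  define T where "T y = \<mu> + form_reflection (matrix_inv S) w (y - \<mu>)" for y
  define F where "F y = ennreal (det S powr (- 1 / 2) * g (mahalanobis_sq \<mu> S y))" for y
  note K = positive_definite_matrix_inv[OF S]
  have P: "P = density lborel F"
    using P unfolding has_elliptical_density_def F_def by blast
  have F: "F \<in> borel_measurable borel"
    unfolding F_def using assms(2) unfolding has_elliptical_density_def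
    by (intro measurable_compose[OF _ measurable_ennreal]) blast
  have "F (T y) = F y" for y
    by (simp add: F_def T_def mahalanobis_sq_def form_reflection_isometry[OF K])
  \<comment> \<open>Writing the density as \<open>F (T y)\<close> allows it to be pulled out of the
    image measure.\<close>
  then have "distr P borel T = distr (density lborel (\<lambda>y. F (T y))) borel T"
    by (simp add: P)
  also have "\<dots> = density (distr lborel borel T) F"
  proof (rule density_distr[symmetric])
    have [measurable]: "form_reflection (matrix_inv S) w \<in> borel_measurable borel"
      by (intro linear_borel_measurable linear_form_reflection)
    show "T \<in> measurable lborel borel"
      unfolding T_def by simp
  qed (use F in simp)
  also have "distr lborel borel T = lborel"
    unfolding T_def by (intro lborel_distr_affine_involution linear_form_reflection form_reflection_involution K)
  finally show ?thesis
    by (simp add: P T_def)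
qed

subsection \<open>Influence functions\<close>

text \<open>Taking image measures respects mixtures and sends the point mass at \<open>y\<close> to
  the point mass at \<open>T y\<close>.\<close>

lemma distr_contaminate:
  assumes T: "T \<in> measurable M N" and y: "y \<in> space M"
  shows "distr (contaminate h y M) N T = contaminate h (T y) (distr M N T)"
proof (rule measure_eqI)
  fix A assume "A \<in> sets (distr (contaminate h y M) N T)"
  then have A: "A \<in> sets N" by simp
  have T': "T \<in> measurable (contaminate h y M) N"
    using T by (simp cong: measurable_cong_sets)
  show "emeasure (distr (contaminate h y M) N T) A = emeasure (contaminate h (T y) (distr M N T)) A"
    using A T y measurable_sets[OF T A]
    by (simp add: emeasure_distr[OF T'] emeasure_distr emeasure_contaminate indicator_def)
qed simp

text \<open>A linear map on a finite-dimensional space is continuous and passes through the limit of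
  difference quotients. Two functionals and two points are allowed, to cover both equivariance,
  where the point moves, and projection, where the functional changes.\<close>

lemma has_influence_linear_image:
  fixes F :: "'b::euclidean_space \<Rightarrow> 'c::real_normed_vector"
  assumes "has_influence y T P v" "linear F"
    and "\<And>h. 0 < h \<Longrightarrow> h < 1 \<Longrightarrow> T' (contaminate h y' P) = F (T (contaminate h y P))"
    and "T' P = F (T P)"
  shows "has_influence y' T' P (F v)"
proof -
  have "((\<lambda>h. F ((T (contaminate h y P) - T P) /\<^sub>R h)) \<longlongrightarrow> F v) (at_right 0)"
    using assms(1,2) unfolding has_influence_def
    by (intro bounded_linear.tendsto[of F]) (simp_all add: linear_conv_bounded_linear)
  moreover have "\<forall>\<^sub>F h in at_right 0. F ((T (contaminate h y P) - T P) /\<^sub>R h) =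
      (T' (contaminate h y' P) - T' P) /\<^sub>R h"
    using eventually_at_right_real[of 0 1] assms(2-)
    by (auto elim!: eventually_mono simp: linear_cmul linear_diff)
  ultimately show ?thesis
    unfolding has_influence_def by (rule Lim_transform_eventually)
qed

lemma has_influence_unique:
  "has_influence y T P v \<Longrightarrow> has_influence y T P v' \<Longrightarrow> v = v'"
  unfolding has_influence_def by (rule tendsto_unique[OF trivial_limit_at_right_real])

lemma linear_congruence_mat:
  fixes A :: "real^'n^'m"
  shows "linear (\<lambda>X. A ** X ** transpose A)"
  by (rule linearI)
    (simp_all add: vec_eq_iff matrix_matrix_mult_def sum.distrib distrib_left distrib_right
      sum_distrib_left mult_ac)

text \<open>An affine map that fixes \<open>P\<close> carries the contamination at \<open>y\<close>
  to the contamination at its image point; equivariance then transforms every difference quotient by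
  the same congruence.\<close>

lemma has_influence_affine:
  assumes P: "P \<in> space (prob_algebra borel)" and C: "affine_equivariant C" and A: "invertible A"
    and inv: "distr P borel (\<lambda>y. A *v y + b) = P"
    and y: "has_influence y C P X"
  shows "has_influence (A *v y + b) C P (A ** X ** transpose A)"
proof (rule has_influence_linear_image[OF y])
  have sets: "sets P = sets borel" "space P = UNIV"
    using P sets_eq_imp_space_eq[of P borel] by (auto simp: space_prob_algebra)
  have "(\<lambda>y. A *v y + b) \<in> measurable P borel"
    using sets(1) by (simp add: borel_measurable_continuous_onI continuous_intros cong: measurable_cong_sets)
  then have "contaminate h (A *v y + b) P = distr (contaminate h y P) borel (\<lambda>y. A *v y + b)" for h
    using sets(2) by (simp add: distr_contaminate inv)
  then show "C (contaminate h (A *v y + b) P) = A ** C (contaminate h y P) ** transpose A"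
    if "0 < h" "h < 1" for h
    using C A contaminate_in_prob_algebra[OF P, of h y] that by (simp add: affine_equivariant_def)
  show "C P = A ** C P ** transpose A"
    using C A P inv unfolding affine_equivariant_def by metis
qed (rule linear_congruence_mat)

section \<open>The influence function of an equivariant functional at an elliptical
  distribution\<close>

lemma outer_square_mult_vector: "outer_square z *v v = (z \<bullet> v) *\<^sub>R z"
  by (simp add: outer_square_def vec_eq_iff matrix_vector_mult_def matrix_matrix_mult_def
      columnvector_def rowvector_def inner_vec_def sum_distrib_left mult_ac)

lemma outer_square_congruence: "A ** outer_square z ** transpose A = outer_square (A *v z)"
proof -
  have "(A ** outer_square z ** transpose A) *v v = outer_square (A *v z) *v v" for v
    by (simp add: outer_square_mult_vector matrix_vector_mult_scaleR transpose_matrix_vector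
        dot_lmul_matrix inner_commute[of z] inner_commute[of "A *v z"] flip: matrix_vector_mul_assoc)
  then show ?thesis
    by (simp add: matrix_eq)
qed

text \<open>Self-adjointness of the reflection with respect to \<open>K\<close> means
  \<open>transpose B = K ** B ** S\<close>. Congruence by \<open>B\<close> thus becomes a product in
  which the transpose is gone and \<open>B ** B = mat 1\<close> can be used.\<close>

lemma form_reflection_congruence:
  fixes S :: "real^'k^'k" and w :: "real^'k"
  assumes S: "positive_definite_mat S"
  defines "K \<equiv> matrix_inv S"
  defines "B \<equiv> matrix (form_reflection K w)"
  shows "B ** X ** transpose B = B ** X ** K ** B ** S"
    and "B ** S ** transpose B = S"
    and "B ** B = mat 1"
proof -
  note K = positive_definite_matrix_inv[OF S, folded K_def]
  note KS = invertible_matrix_inv_mult[OF positive_definite_invertible[OF S], folded K_def]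
  have B: "B *v x = form_reflection K w x" for x
    unfolding B_def by (simp add: linear_form_reflection)
  show BB: "B ** B = mat 1"
    by (simp add: matrix_eq B form_reflection_involution[OF K] flip: matrix_vector_mul_assoc)
  have "transpose B ** K = K ** B"
  proof -
    have "x \<bullet> ((transpose B ** K) *v y) = x \<bullet> ((K ** B) *v y)" for x y
      using form_reflection_adjoint[OF K, of w x y]
      by (simp add: B[symmetric] transpose_matrix_vector inner_commute[of x] dot_lmul_matrix
          flip: matrix_vector_mul_assoc) (simp add: inner_commute)
    then show ?thesis
      unfolding matrix_eq by (blast intro: vector_eq_ldot[THEN iffD1])
  qed
  then have "transpose B ** K ** S = K ** B ** S"
    by simp
  then have tB: "transpose B = K ** B ** S"
    by (simp add: KS flip: matrix_mul_assoc)
  then show "B ** X ** transpose B = B ** X ** K ** B ** S" for X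
    by (simp add: matrix_mul_assoc)
  have "B ** S ** transpose B = B ** (S ** K) ** B ** S"
    by (simp add: tB matrix_mul_assoc)
  then show "B ** S ** transpose B = S"
    by (simp add: KS BB)
qed

lemma influence_reflect:
  fixes S :: "real^'k^'k" and w :: "real^'k"
  assumes P: "P \<in> space (prob_algebra borel)" and S: "positive_definite_mat S"
    and ell: "has_elliptical_density P g \<mu> S"
    and C: "affine_equivariant C" and y: "has_influence y C P X"
  defines "K \<equiv> matrix_inv S" 
  defines "B \<equiv> matrix (form_reflection K w)"
  shows "has_influence (\<mu> + form_reflection K w (y - \<mu>)) C P (B ** X ** transpose (B))"
proof -
  have B: "B *v x = form_reflection K w x" for x
    unfolding B_def by (simp add: linear_form_reflection)
  have inv: "invertible (B)"
    unfolding invertible_def B_def K_def using form_reflection_congruence(3)[OF S] by blast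
  \<comment> \<open>With this shift, reflecting around \<open>\<mu>\<close> takes the form
    \<open>B *v z + b\<close> required by affine equivariance.\<close>
  define b where "b = \<mu> - B *v \<mu>"
  have aff: "\<mu> + form_reflection K w (z - \<mu>) = B *v z + b" for z
    by (simp add: b_def matrix_vector_mult_diff_distrib flip: B)
  have "distr P borel (\<lambda>z. B *v z + b) = P"
    using elliptical_distr_reflection[OF S ell, of w] by (simp add: aff flip: K_def)
  then show ?thesis
    unfolding aff by (intro has_influence_affine P C inv y)
qed

text \<open>A reflection along \<open>w\<close> orthogonal to \<open>y - \<mu>\<close> fixes
  \<open>y\<close>. Uniqueness of the limit makes \<open>X\<close> invariant under its congruence,
  which says that \<open>X ** K\<close> commutes with the reflection.\<close>

lemma influence_at_point:
  assumes P: "P \<in> space (prob_algebra borel)" and S: "positive_definite_mat S"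
    and ell: "has_elliptical_density P g \<mu> S"
    and C: "affine_equivariant C" and y: "has_influence y C P X"
  shows "\<exists>\<alpha> \<beta>. X = \<alpha> *\<^sub>R outer_square (y - \<mu>) - \<beta> *\<^sub>R S"
proof -
  define K where "K = matrix_inv S"
  define z where "z = y - \<mu>"
  note K = positive_definite_matrix_inv[OF S, folded K_def]
  note KS = invertible_matrix_inv_mult[OF positive_definite_invertible[OF S], folded K_def]
  have comm: "(X ** K) *v form_reflection K w x = form_reflection K w ((X ** K) *v x)"
    if w: "w \<bullet> (K *v z) = 0" for w x
  proof -
    define B where "B = matrix (form_reflection K w)"
    note cong = form_reflection_congruence[OF S, where w = w, folded K_def, folded B_def]
    have B: "B *v x = form_reflection K w x" for x
      unfolding B_def by (simp add: linear_form_reflection)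
    have "has_influence y C P (B ** X ** transpose B)"
      using influence_reflect[OF P S ell C y, of w] form_reflection_fixes[OF w]
      by (simp add: z_def flip: K_def B_def)
    then have "B ** X ** K ** B ** S = X"
      unfolding cong(1) by (rule has_influence_unique[OF _ y])
    \<comment> \<open>Multiplying by \<open>B\<close> on the left and \<open>K\<close> on the right
      cancels \<open>B ** B\<close> and \<open>S ** K\<close> and leaves the commutation
      relation.\<close>
    then have "B ** (B ** X ** K ** B ** S) ** K = B ** X ** K"
      by simp
    then have "(B ** B) ** X ** K ** B ** (S ** K) = B ** X ** K"
      by (simp only: matrix_mul_assoc)
    then have "X ** K ** B = B ** (X ** K)"
      by (simp add: KS cong(3) matrix_mul_assoc)
    then show ?thesis
      by (metis B matrix_vector_mul_assoc)
  qed
  obtain a b where ab: "(X ** K) *v x = b *\<^sub>R x + (a * (z \<bullet> (K *v x))) *\<^sub>R z" for x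
    using commutes_with_stabilizing_reflections[OF K matrix_vector_mul_linear comm] by metis
  have "X *v v = (a *\<^sub>R outer_square z - (- b) *\<^sub>R S) *v v" for v
  proof -
    have "X *v v = (X ** K) *v (S *v v)"
      by (simp add: matrix_vector_mul_assoc KS flip: matrix_mul_assoc)
    also have "\<dots> = b *\<^sub>R (S *v v) + (a * (z \<bullet> v)) *\<^sub>R z"
      unfolding ab by (simp add: matrix_vector_mul_assoc KS)
    finally show ?thesis
      by (simp add: matrix_vector_mult_add_rdistrib scaleR_matrix_vector_assoc[symmetric] outer_square_mult_vector)
  qed
  then show ?thesis
    unfolding z_def by (metis matrix_eq)
qed

text \<open>The coefficients at a single point need not be unique, as in dimension one. They are
  therefore read off at one representative of each distance and carried by reflections to all points
  at that distance.\<close>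

lemma influence_structure:
  assumes P: "P \<in> space (prob_algebra borel)" and S: "positive_definite_mat S"
    and ell: "has_elliptical_density P g \<mu> S"
    and C: "affine_equivariant C" and infl: "possesses_influence_function C P"
  defines "d \<equiv> mahalanobis \<mu> S"
  shows "\<exists>\<alpha> \<beta>. \<forall>y. has_influence y C P (\<alpha> (d y) *\<^sub>R outer_square (y - \<mu>) - \<beta> (d y) *\<^sub>R S)"
proof -
  define K where "K = matrix_inv S"
  note K = positive_definite_matrix_inv[OF S, folded K_def]
  have "\<exists>\<alpha> \<beta>. has_influence y C P (\<alpha> *\<^sub>R outer_square (y - \<mu>) - \<beta> *\<^sub>R S)" for y
    using infl influence_at_point[OF P S ell C] unfolding possesses_influence_function_def by metis
  then obtain a b where ab: "has_influence y C P (a y *\<^sub>R outer_square (y - \<mu>) - b y *\<^sub>R S)" for y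
    by metis
  have move: "has_influence y' C P (\<alpha> *\<^sub>R outer_square (y' - \<mu>) - \<beta> *\<^sub>R S)"
    if y: "has_influence y C P (\<alpha> *\<^sub>R outer_square (y - \<mu>) - \<beta> *\<^sub>R S)" and "d y = d y'" for y y' \<alpha> \<beta>
  proof -
    \<comment> \<open>The reflection along this difference exchanges the two centred points, which
      have equal length.\<close>
    define w where "w = (y - \<mu>) - (y' - \<mu>)"
    define B where "B = matrix (form_reflection K w)"
    note cong = form_reflection_congruence[OF S, where w = w, folded K_def, folded B_def]
    have "mahalanobis_sq \<mu> S y = mahalanobis_sq \<mu> S y'"
      using \<open>d y = d y'\<close> by (simp add: d_def mahalanobis_def)
    then have swap: "form_reflection K w (y - \<mu>) = y' - \<mu>"
      unfolding w_def mahalanobis_sq_def K_def[symmetric] by (intro form_reflection_swaps K)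
    have B: "B *v (y - \<mu>) = y' - \<mu>"
      unfolding B_def by (simp add: linear_form_reflection swap)
    have lin: "linear (\<lambda>X. B ** X ** transpose B)"
      by (rule linear_congruence_mat)
    have "B ** (\<alpha> *\<^sub>R outer_square (y - \<mu>) - \<beta> *\<^sub>R S) ** transpose B =
        \<alpha> *\<^sub>R outer_square (y' - \<mu>) - \<beta> *\<^sub>R S"
      using linear_diff[OF lin] linear_cmul[OF lin] by (simp add: cong(2) outer_square_congruence B)
    then show ?thesis
      using influence_reflect[OF P S ell C y, of w] swap by (simp flip: K_def B_def)
  qed
  \<comment> \<open>\<open>r\<close> selects one point for each attained distance; \<alpha> and
    \<beta> are the pointwise coefficients at that point.\<close>
  define r where "r = inv d"
  have "d (r (d y)) = d y" for y
    unfolding r_def by (rule f_inv_into_f) simp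
  then have "has_influence y C P (a (r (d y)) *\<^sub>R outer_square (y - \<mu>) - b (r (d y)) *\<^sub>R S)" for y
    using move ab by blast
  then show ?thesis
    by (intro exI[of _ "a \<circ> r"] exI[of _ "b \<circ> r"]) simp
qed

section \<open>Projection of the influence function onto the linear covariance structure\<close>

lemma linear_vec_cols: "linear vec_cols"
  by (rule linearI) (simp_all add: vec_cols_def vec_eq_iff)

lemma inj_vec_cols: "vec_cols A = vec_cols B \<Longrightarrow> A = B"
  by (simp add: vec_cols_def vec_eq_iff)

theorem lemma1:
  fixes P :: "(real^'k) measure"
    and g :: "real \<Rightarrow> real"
    and \<mu> :: "real^'k"
    and \<Sigma> :: "real^'k^'k"
    and C M :: "(real^'k) measure \<Rightarrow> real^'k^'k"
    and Ls :: "'l::finite \<Rightarrow> real^'k^'k"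
    and \<theta>\<^sub>0 :: "real^'l"
  defines "L \<equiv> design_mat Ls"
    and "W \<equiv> matrix_inv \<Sigma> \<otimes>\<^sub>K matrix_inv \<Sigma>"
    and "d \<equiv> mahalanobis \<mu> \<Sigma>"
  assumes "P \<in> space (prob_algebra borel)"
    and "positive_definite_mat \<Sigma>"
    and "has_elliptical_density P g \<mu> \<Sigma>"
    and "covariance_functional C"
    and "affine_equivariant C"
    and "possesses_influence_function C P"
    and "fisher_consistent C P \<Sigma>"
    and "\<And>j. symmetric_mat (Ls j)"
    and "rank L = CARD('l)"
    and "\<Sigma> = lin_cov Ls \<theta>\<^sub>0"
    and "\<And>Q. Q \<in> space (prob_algebra borel) \<Longrightarrow>
           vec_cols (M Q) = scaled_proj \<Sigma> L (vec_cols (C Q))"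
  shows "fisher_consistent M P \<Sigma> \<and>
    (\<exists>\<alpha> \<beta> :: real \<Rightarrow> real.
       (\<forall>y. has_influence y (\<lambda>Q. vec_cols (M Q)) P
          (\<alpha> (d y) *\<^sub>R ((L ** matrix_inv (transpose L ** W ** L) ** transpose L) *v
              vec_cols (matrix_inv \<Sigma> ** outer_square (y - \<mu>) ** matrix_inv \<Sigma>))
            - \<beta> (d y) *\<^sub>R vec_cols \<Sigma>)) \<and>
       (\<forall>\<theta> :: (real^'k) measure \<Rightarrow> real^'l.
          (\<forall>Q \<in> space (prob_algebra borel). vec_cols (M Q) = L *v \<theta> Q) \<longrightarrow>
          fisher_consistent \<theta> P \<theta>\<^sub>0 \<and>
          (\<forall>y. has_influence y \<theta> P
            (\<alpha> (d y) *\<^sub>R ((matrix_inv (transpose L ** W ** L) ** transpose L) *v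
                vec_cols (matrix_inv \<Sigma> ** outer_square (y - \<mu>) ** matrix_inv \<Sigma>))
              - \<beta> (d y) *\<^sub>R \<theta>\<^sub>0))))"
proof -
  note P = assms(4) and \<Sigma> = assms(5) and C_fisher = assms(10)[unfolded fisher_consistent_def]
  define G where "G = transpose L ** W ** L"
  define H where "H = matrix_inv G ** transpose L ** W"
  \<comment> \<open>\<open>F X\<close> is the coefficient vector of the projection of
    \<open>vec_cols X\<close>. At probability measures \<open>vec_cols (M Q)\<close> is
    \<open>L *v F (C Q)\<close>, and \<open>\<theta> Q\<close> will be \<open>F (C Q)\<close>; both
    influence functions come from that of \<open>C\<close> through \<open>F\<close>.\<close>
  define F where "F X = H *v vec_cols X" for X
  have L: "inj ((*v) L)"
    using assms(12) by (simp add: full_rank_injective)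
  have vec_M: "vec_cols (M Q) = L *v F (C Q)" if "Q \<in> space (prob_algebra borel)" for Q
    using that by (simp add: assms(14) scaled_proj_eq[OF \<Sigma> L] F_def H_def G_def W_def)
  have F: "linear F"
    using linear_compose[OF linear_vec_cols matrix_vector_mul_linear[of H]]
    by (simp add: F_def[abs_def] o_def)
  have vec_\<Sigma>: "vec_cols \<Sigma> = L *v \<theta>\<^sub>0"
    unfolding L_def by (subst assms(13)) (rule vec_cols_lin_cov)
  have W: "positive_definite_mat W"
    unfolding W_def by (intro positive_definite_kron positive_definite_matrix_inv \<Sigma>)
  have "invertible G"
    unfolding G_def by (intro positive_definite_invertible positive_definite_gram W L)
  \<comment> \<open>As \<open>vec_cols \<Sigma>\<close> lies in the column space of \<open>L\<close>
    with coefficients \<open>\<theta>\<^sub>0\<close>, the factor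
    \<open>transpose L ** W ** L\<close> appears and cancels against its inverse.\<close>
  moreover have "F \<Sigma> = (matrix_inv G ** G) *v \<theta>\<^sub>0"
    by (simp add: F_def vec_\<Sigma> H_def G_def matrix_vector_mul_assoc matrix_mul_assoc)
  ultimately have F_\<Sigma>: "F \<Sigma> = \<theta>\<^sub>0"
    by (simp add: invertible_matrix_inv_mult)
  have "transpose (matrix_inv \<Sigma>) = matrix_inv \<Sigma>"
    using positive_definite_matrix_inv[OF \<Sigma>] by (simp add: positive_definite_mat_def symmetric_mat_def)
  \<comment> \<open>Here the weight \<open>W\<close> of the projection becomes the two factors
    \<open>matrix_inv \<Sigma>\<close> around the outer square in the stated formulas.\<close>
  then have "W *v vec_cols X = vec_cols (matrix_inv \<Sigma> ** X ** matrix_inv \<Sigma>)" for X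
    by (simp add: W_def kron_mult_vec_cols)
  then have F_eq: "F X = (matrix_inv G ** transpose L) *v
      vec_cols (matrix_inv \<Sigma> ** X ** matrix_inv \<Sigma>)" for X
    by (simp add: F_def H_def flip: matrix_vector_mul_assoc)
  obtain \<alpha> \<beta> where IF: "\<And>y. has_influence y C P (\<alpha> (d y) *\<^sub>R outer_square (y - \<mu>) - \<beta> (d y) *\<^sub>R \<Sigma>)"
    unfolding d_def using influence_structure[OF P \<Sigma> assms(6,8,9)] by blast
  have F_IF: "F (\<alpha> (d y) *\<^sub>R outer_square (y - \<mu>) - \<beta> (d y) *\<^sub>R \<Sigma>) =
      \<alpha> (d y) *\<^sub>R ((matrix_inv G ** transpose L) *v
        vec_cols (matrix_inv \<Sigma> ** outer_square (y - \<mu>) ** matrix_inv \<Sigma>)) - \<beta> (d y) *\<^sub>R \<theta>\<^sub>0" for y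
    unfolding linear_diff[OF F] linear_cmul[OF F] F_\<Sigma> by (simp only: F_eq)
  note contam = contaminate_in_prob_algebra[OF P less_imp_le less_imp_le]
  have IF_\<theta>: "has_influence y \<theta> P (F (\<alpha> (d y) *\<^sub>R outer_square (y - \<mu>) - \<beta> (d y) *\<^sub>R \<Sigma>))"
    if "\<forall>Q \<in> space (prob_algebra borel). \<theta> Q = F (C Q)" for \<theta> y
    by (rule has_influence_linear_image[OF IF F]) (use that P contam in auto)
  have "vec_cols (M P) = vec_cols \<Sigma>"
    by (simp add: vec_M P C_fisher F_\<Sigma> vec_\<Sigma>)
  then have "fisher_consistent M P \<Sigma>"
    by (simp add: fisher_consistent_def inj_vec_cols)
  moreover have "has_influence y (\<lambda>Q. vec_cols (M Q)) P
      (\<alpha> (d y) *\<^sub>R ((L ** matrix_inv G ** transpose L) *v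
          vec_cols (matrix_inv \<Sigma> ** outer_square (y - \<mu>) ** matrix_inv \<Sigma>))
        - \<beta> (d y) *\<^sub>R vec_cols \<Sigma>)" for y
  proof -
    have "has_influence y (\<lambda>Q. F (C Q)) P (F (\<alpha> (d y) *\<^sub>R outer_square (y - \<mu>) - \<beta> (d y) *\<^sub>R \<Sigma>))"
      by (rule IF_\<theta>) simp
    then have "has_influence y (\<lambda>Q. vec_cols (M Q)) P
        (L *v F (\<alpha> (d y) *\<^sub>R outer_square (y - \<mu>) - \<beta> (d y) *\<^sub>R \<Sigma>))"
      by (rule has_influence_linear_image) (simp_all add: matrix_vector_mul_linear vec_M P contam)
    then show ?thesis
      unfolding F_IF
      by (simp add: matrix_vector_mult_diff_distrib matrix_vector_mult_scaleR vec_\<Sigma>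
          matrix_vector_mul_assoc matrix_mul_assoc)
  qed
  moreover have "fisher_consistent \<theta> P \<theta>\<^sub>0 \<and>
      (\<forall>y. has_influence y \<theta> P
        (\<alpha> (d y) *\<^sub>R ((matrix_inv G ** transpose L) *v
            vec_cols (matrix_inv \<Sigma> ** outer_square (y - \<mu>) ** matrix_inv \<Sigma>))
          - \<beta> (d y) *\<^sub>R \<theta>\<^sub>0))"
    if "\<forall>Q \<in> space (prob_algebra borel). vec_cols (M Q) = L *v \<theta> Q"
    for \<theta> :: "(real^'k) measure \<Rightarrow> real^'l"
  proof -
    \<comment> \<open>Injectivity of \<open>L\<close> leaves only one possible coefficient vector at
      each probability measure.\<close>
    have \<theta>: "\<forall>Q \<in> space (prob_algebra borel). \<theta> Q = F (C Q)"
      using that vec_M injD[OF L] by metis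
    then have "\<theta> P = \<theta>\<^sub>0"
      using P by (simp add: C_fisher F_\<Sigma>)
    with IF_\<theta>[OF \<theta>] show ?thesis
      unfolding F_IF fisher_consistent_def by blast
  qed
  ultimately show ?thesis
    unfolding G_def by blast
qed

end
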